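(* Let $a>b>0$, $0<\lambda<b^2$, $c=\sqrt{a^2-b^2}$, let $E=\{\frac{x^2}{a^2}+\frac{y^2}{b^2}=1\}$ be the billiard table and $E_\lambda=\{\frac{x^2}{a^2-\lambda}+\frac{y^2}{b^2-\lambda}=1\}$ a confocal caustic, and put $e=\frac ac$, $f=\frac{\sqrt{a^2-\lambda}}{c}$. Then the rotation number of the billiard in $E$ on the invariant curve corresponding to the caustic $E_\lambda$ is $$\rho=\frac{F(\phi,k)}{2K(k)},\qquad k=\frac1f,\qquad \phi=\arcsin\sqrt{\frac{e^2-f^2}{e^2-1}}=\arcsin\frac{\sqrt\lambda}{b}.$$
   Context: $F(\varphi,k)=\int_0^\varphi\frac{dt}{\sqrt{1-k^2\sin^2t}}$ is the elliptic integral of the first kind and $K(k)=F(\pi/2,k)$ the complete one. Billiard trajectories in $E$ with one edge tangent to $E_\lambda$ have all edges tangent to $E_\lambda$; they are traversed counterclockwise. The oriented lines tangent counterclockwise to $E_\lambda$ form the invariant curve of the billiard map corresponding to $E_\lambda$. The rotation number $\rho\in(0,\tfrac12)$ of this curve is the average number of turns around the centre per reflection: if a trajectory closes after $n$ reflections making $m$ turns, then $\rho=m/n$; in general, if $\theta_i$ is a continuously lifted polar angle of the $i$-th reflection point, with $0<\theta_{i+1}-\theta_i<2\pi$, then $\rho=\lim_{N\to\infty}\frac{\theta_N-\theta_0}{2\pi N}$. The term "eccentricity" in this setting means $e=a/c$ for $E$ and $f=\sqrt{a^2-\lambda}/c$ for $E_\lambda$ (the reciprocals of the usual eccentricities). 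*)

theory Defs
  imports "HOL-Analysis.Analysis"
begin

type_synonym point = "real \<times> real"

definition ellip_F :: "real \<Rightarrow> real \<Rightarrow> real" where
  \<comment> \<open>For a negative amplitude this is the junk value 0 (empty interval); only
    amplitudes between 0 and pi/2 are of interest.\<close>
  "ellip_F \<phi> k = integral {0..\<phi>} (\<lambda>t. 1 / sqrt (1 - k\<^sup>2 * (sin t)\<^sup>2))"

definition ellip_K :: "real \<Rightarrow> real" where
  "ellip_K k = ellip_F (pi / 2) k"

definition ellipse :: "real \<Rightarrow> real \<Rightarrow> point set" where
  \<comment> \<open>The parameters are the squares of the semi-axes.\<close>
  "ellipse A B = {(x, y). x\<^sup>2 / A + y\<^sup>2 / B = 1}"

definition ellipse_normal :: "real \<Rightarrow> real \<Rightarrow> point \<Rightarrow> point" where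
  \<comment> \<open>Half the gradient of the defining function; on the ellipse, an outer normal.\<close>
  "ellipse_normal A B p = (fst p / A, snd p / B)"

definition ellipse_ccw_tangent :: "real \<Rightarrow> real \<Rightarrow> point \<Rightarrow> point" where
  \<comment> \<open>The outer normal rotated by +pi/2: a tangent vector pointing counterclockwise.\<close>
  "ellipse_ccw_tangent A B p = (- (snd p / B), fst p / A)"

definition ccw_tangent_line :: "real \<Rightarrow> real \<Rightarrow> point \<Rightarrow> point \<Rightarrow> bool" where
  \<comment> \<open>The line through p and q, oriented from p to q, touches the ellipse at a point z
    and has there the counterclockwise direction.\<close>
  "ccw_tangent_line A B p q \<longleftrightarrow>
     (\<exists>z \<in> ellipse A B. (\<exists>t. z = p + t *\<^sub>R (q - p)) \<and>
        (\<exists>s>0. q - p = s *\<^sub>R ellipse_ccw_tangent A B z))"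

definition reflect_dir :: "point \<Rightarrow> point \<Rightarrow> point" where
  \<comment> \<open>Reflection of the direction v in the line orthogonal to n.\<close>
  "reflect_dir n v = v - (2 * (v \<bullet> n) / (n \<bullet> n)) *\<^sub>R n"

definition billiard_trajectory :: "real \<Rightarrow> real \<Rightarrow> (nat \<Rightarrow> point) \<Rightarrow> bool" where
  \<comment> \<open>Consecutive reflection points in the ellipse with semi-axes a and b; the
    function sgn normalises a vector to unit length.\<close>
  "billiard_trajectory a b p \<longleftrightarrow>
     (\<forall>i. p i \<in> ellipse (a\<^sup>2) (b\<^sup>2)) \<and>
     (\<forall>i. p (Suc i) \<noteq> p i) \<and>
     (\<forall>i. sgn (p (Suc (Suc i)) - p (Suc i)) =
        reflect_dir (ellipse_normal (a\<^sup>2) (b\<^sup>2) (p (Suc i))) (sgn (p (Suc i) - p i)))"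

definition invariant_curve :: "real \<Rightarrow> real \<Rightarrow> real \<Rightarrow> (point \<times> point) set" where
  \<comment> \<open>An oriented line crossing the table is represented by the pair of its
    entry point and exit point.\<close>
  "invariant_curve a b l =
     {(p, q). p \<in> ellipse (a\<^sup>2) (b\<^sup>2) \<and> q \<in> ellipse (a\<^sup>2) (b\<^sup>2) \<and> p \<noteq> q \<and>
        ccw_tangent_line (a\<^sup>2 - l) (b\<^sup>2 - l) p q}"

definition polar_lift :: "(nat \<Rightarrow> point) \<Rightarrow> (nat \<Rightarrow> real) \<Rightarrow> bool" where
  "polar_lift p \<theta> \<longleftrightarrow>
     (\<forall>i. p i = norm (p i) *\<^sub>R (cos (\<theta> i), sin (\<theta> i))) \<and>
     (\<forall>i. 0 < \<theta> (Suc i) - \<theta> i \<and> \<theta> (Suc i) - \<theta> i < 2 * pi)"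

definition has_rotation_number :: "real \<Rightarrow> real \<Rightarrow> real \<Rightarrow> real \<Rightarrow> bool" where
  \<comment> \<open>Only the initial edge is required to lie on the invariant curve: that all later
    edges do is a property of the billiard, not an assumption. The first two conjuncts
    (the curve is nonempty, and each of its lines starts a trajectory having a
    lifted polar angle) keep the last one from holding vacuously.\<close>
  "has_rotation_number a b l \<rho> \<longleftrightarrow>
     invariant_curve a b l \<noteq> {} \<and>
     (\<forall>(q, r) \<in> invariant_curve a b l.
        \<exists>p \<theta>. billiard_trajectory a b p \<and> p 0 = q \<and> p 1 = r \<and> polar_lift p \<theta>) \<and>
     (\<forall>p \<theta>. billiard_trajectory a b p \<longrightarrow> (p 0, p 1) \<in> invariant_curve a b l \<longrightarrow>
        polar_lift p \<theta> \<longrightarrow> (\<lambda>N. (\<theta> N - \<theta> 0) / (2 * pi * real N)) \<longlonglongrightarrow> \<rho>)"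

end

theory Submission
  imports Defs
begin

text \<open>
  Parametrise the table by \<open>P(x) = (- a sin x, b cos x)\<close>, so that \<open>x = 0\<close> is the top vertex. With
  \<open>t = x + y\<close> and \<open>w = y - x\<close>, the chord from \<open>P(x)\<close> to \<open>P(y)\<close> touches the caustic counterclockwise
  iff \<open>0 < w < \<pi>\<close> and \<open>cos w = \<mu> - \<nu> cos t\<close>, which determines \<open>w\<close> as a function of \<open>t\<close>. If \<open>G\<close> is an
  antiderivative of \<open>1 / sqrt (1 - k\<^sup>2 sin\<^sup>2 x)\<close>, then \<open>G(y) - G(x)\<close> has derivative zero as a
  function of \<open>t\<close>, and the horizontal chord \<open>t = 0\<close> gives its value \<open>2 F(\<phi>, k)\<close>. So \<open>G\<close> turns
  the billiard map on the invariant curve into a translation by \<open>2 F(\<phi>, k)\<close>, while a full turn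
  increases \<open>G\<close> by \<open>4 K(k)\<close>. The polar angle of \<open>P(x)\<close> stays within \<open>\<pi>/2\<close> of \<open>x + \<pi>/2\<close>, and \<open>G\<close> stays
  within bounded distance of a linear function, so the average of the polar angle is the ratio of
  the two.
\<close>

section \<open>Periodic functions, plane reflection, uniqueness of trajectories and of polar
  lifts\<close>

lemma periodic_bounded:
  fixes h :: "real \<Rightarrow> real"
  assumes "0 < T" and per: "\<And>x. h (x + T) = h x" and cont: "continuous_on UNIV h"
  obtains C where "\<And>x. \<bar>h x\<bar> \<le> C"
proof -
  have "compact (h ` {0..T})"
    using cont by (intro compact_continuous_image) (auto intro: continuous_on_subset)
  then obtain C where C: "\<And>y. y \<in> h ` {0..T} \<Longrightarrow> \<bar>y\<bar> \<le> C"
    using bounded_real compact_imp_bounded by metis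
  have nat: "h (x + real n * T) = h x" for x n
  proof (induction n)
    case (Suc n)
    have "h (x + real (Suc n) * T) = h ((x + real n * T) + T)"
      by (simp add: algebra_simps)
    then show ?case using per Suc by simp
  qed simp
  have int: "h (x + of_int i * T) = h x" for x i
  proof (cases "i \<ge> 0")
    case True
    then show ?thesis using nat[of x "nat i"] by simp
  next
    case False
    then show ?thesis using nat[of "x + of_int i * T" "nat (- i)"] by simp
  qed
  show ?thesis
  proof
    fix x
    define i where "i = \<lfloor>x / T\<rfloor>"
    have "of_int i \<le> x / T" "x / T < of_int i + 1"
      unfolding i_def by linarith+
    then have "of_int i * T \<le> x" "x \<le> (of_int i + 1) * T"
      using \<open>0 < T\<close> by (auto simp: field_simps)
    then have "x + of_int (- i) * T \<in> {0..T}"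
      by (auto simp: algebra_simps)
    then have "\<bar>h (x + of_int (- i) * T)\<bar> \<le> C" using C by blast
    then show "\<bar>h x\<bar> \<le> C" using int by metis
  qed
qed

text \<open>The tangential component of \<open>v\<close> agrees with that of \<open>u\<close> up to
  sign; opposite signs would mean \<open>v = - u\<close>, which \<open>uv\<close> excludes.\<close>

lemma reflect_dir_unique:
  fixes u v n :: point
  assumes n: "n \<noteq> 0" and uv: "u + v \<noteq> 0" and norm: "norm u = norm v"
    and inner: "v \<bullet> n = - (u \<bullet> n)"
  shows "v = reflect_dir n u"
proof -
  obtain u1 u2 where u: "u = (u1, u2)" by (cases u)
  obtain v1 v2 where v: "v = (v1, v2)" by (cases v)
  obtain n1 n2 where nn: "n = (n1, n2)" by (cases n)
  define N where "N = n1\<^sup>2 + n2\<^sup>2"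
  have N: "N > 0" "n \<bullet> n = N"
    using n by (auto simp: N_def nn sum_power2_gt_zero_iff zero_prod_def inner_prod_def)
      (simp_all add: power2_eq_square)
  have o: "(u1 + v1) * n1 + (u2 + v2) * n2 = 0"
    using inner by (simp add: u v nn inner_prod_def algebra_simps)
  \<comment> \<open>\<open>u + v\<close> is orthogonal to \<open>n\<close>, hence \<open>t\<close>
    times the rotated normal \<open>(- n2, n1)\<close>.\<close>
  define t where "t = (n1 * (u2 + v2) - n2 * (u1 + v1)) / N"
  have s1: "u1 + v1 = - t * n2"
  proof -
    have "N * (u1 + v1) = - (n1 * (u2 + v2) - n2 * (u1 + v1)) * n2"
      using o unfolding N_def by algebra
    then show ?thesis using N(1) by (simp add: t_def field_simps)
  qed
  have s2: "u2 + v2 = t * n1"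
  proof -
    have "N * (u2 + v2) = (n1 * (u2 + v2) - n2 * (u1 + v1)) * n1"
      using o unfolding N_def by algebra
    then show ?thesis using N(1) by (simp add: t_def field_simps)
  qed
  have "t \<noteq> 0" using uv s1 s2 by (auto simp: u v zero_prod_def)
  have "u1\<^sup>2 + u2\<^sup>2 = v1\<^sup>2 + v2\<^sup>2" using norm by (simp add: u v norm_Pair)
  \<comment> \<open>Equal norms make \<open>v - u\<close> orthogonal to \<open>u + v\<close>, hence
    parallel to \<open>n\<close>.\<close>
  then have "(v1 - u1) * (u1 + v1) + (v2 - u2) * (u2 + v2) = 0" by algebra
  then have "t * ((v2 - u2) * n1 - (v1 - u1) * n2) = 0"
    unfolding s1 s2 by algebra
  then have par: "(v2 - u2) * n1 = (v1 - u1) * n2" using \<open>t \<noteq> 0\<close> by simp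
  have "N * (v1 - u1) = - 2 * (u1 * n1 + u2 * n2) * n1"
    using par o unfolding N_def by algebra
  moreover have "N * (v2 - u2) = - 2 * (u1 * n1 + u2 * n2) * n2"
    using par o unfolding N_def by algebra
  ultimately show ?thesis
    using N by (simp add: reflect_dir_def u v nn inner_prod_def field_simps)
qed

text \<open>Along the ray the ellipse equation is a quadratic with root 0 at \<open>p\<close>; its
  other root, the distance to the exit point, depends only on \<open>p\<close> and the
  direction.\<close>

lemma ray_meets_ellipse_once:
  assumes "0 < A" "0 < B" "p \<in> ellipse A B" "q \<in> ellipse A B" "r \<in> ellipse A B"
    and "q \<noteq> p" "r \<noteq> p" and sgn: "sgn (q - p) = sgn (r - p)"
  shows "q = r"
proof -
  define w where "w = sgn (q - p)"
  obtain p1 p2 where p: "p = (p1, p2)" by (cases p)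
  obtain w1 w2 where w: "w = (w1, w2)" by (cases w)
  have "w \<noteq> 0" unfolding w_def using \<open>q \<noteq> p\<close> by (simp add: sgn_zero_iff)
  then have pos: "w1\<^sup>2 / A + w2\<^sup>2 / B > 0"
    using assms(1,2) by (auto simp: w zero_prod_def add_pos_nonneg add_nonneg_pos)
  have len: "norm (z - p) = - 2 * (p1 * w1 / A + p2 * w2 / B) / (w1\<^sup>2 / A + w2\<^sup>2 / B)"
    if "z \<in> ellipse A B" "z \<noteq> p" "sgn (z - p) = w" for z
  proof -
    define t where "t = norm (z - p)"
    have "t > 0" using that by (simp add: t_def)
    have "z - p = t *\<^sub>R w" using that by (auto simp: t_def sgn_div_norm)
    then have z: "z = (p1 + t * w1, p2 + t * w2)"
      by (metis add.commute add_Pair diff_add_cancel p real_scaleR_def scaleR_Pair w)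
    have "(p1 + t * w1)\<^sup>2 / A + (p2 + t * w2)\<^sup>2 / B = p1\<^sup>2 / A + p2\<^sup>2 / B"
      using that(1) \<open>p \<in> ellipse A B\<close> by (simp add: ellipse_def z p)
    then have "t * (2 * (p1 * w1 / A + p2 * w2 / B) + t * (w1\<^sup>2 / A + w2\<^sup>2 / B)) = 0"
      by (simp add: power2_eq_square add_divide_distrib algebra_simps)
    then have "2 * (p1 * w1 / A + p2 * w2 / B) + t * (w1\<^sup>2 / A + w2\<^sup>2 / B) = 0"
      using \<open>t > 0\<close> by simp
    then have "t * (w1\<^sup>2 / A + w2\<^sup>2 / B) = - 2 * (p1 * w1 / A + p2 * w2 / B)" by linarith
    then show ?thesis using pos unfolding t_def[symmetric] by (simp add: nonzero_eq_divide_eq)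
  qed
  have "norm (q - p) = norm (r - p)"
    using len[of q] len[of r] assms w_def by simp
  moreover have "norm (q - p) *\<^sub>R sgn (q - p) = q - p" "norm (r - p) *\<^sub>R sgn (r - p) = r - p"
    using \<open>q \<noteq> p\<close> \<open>r \<noteq> p\<close> by (simp_all add: sgn_div_norm)
  ultimately have "q - p = r - p" using sgn by metis
  then show ?thesis by simp
qed

text \<open>The reflection law fixes the next direction, and the direction fixes the next
  point.\<close>

lemma billiard_trajectory_unique:
  assumes "0 < a" "0 < b" "billiard_trajectory a b p" "billiard_trajectory a b p'"
    and "p 0 = p' 0" "p 1 = p' 1"
  shows "p = p'"
proof -
  have "p i = p' i \<and> p (Suc i) = p' (Suc i)" for i
  proof (induction i)
    case (Suc i)
    have "p (Suc (Suc i)) = p' (Suc (Suc i))"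
    proof (rule ray_meets_ellipse_once[of "a\<^sup>2" "b\<^sup>2" "p (Suc i)"])
      have law: "sgn (q (Suc (Suc i)) - q (Suc i)) =
          reflect_dir (ellipse_normal (a\<^sup>2) (b\<^sup>2) (q (Suc i))) (sgn (q (Suc i) - q i))"
        if "billiard_trajectory a b q" for q
        using that by (simp add: billiard_trajectory_def)
      show "sgn (p (Suc (Suc i)) - p (Suc i)) = sgn (p' (Suc (Suc i)) - p (Suc i))"
        using law[OF assms(3)] law[OF assms(4)] Suc by simp
      show "p' (Suc (Suc i)) \<noteq> p (Suc i)"
        using assms Suc by (simp add: billiard_trajectory_def)
    qed (use assms in \<open>auto simp: billiard_trajectory_def\<close>)
    then show ?case using Suc by simp
  qed (use assms in simp)
  then show ?thesis by blast
qed

text \<open>Corresponding increments agree modulo \<open>2 * pi\<close> and both lie strictly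
  between 0 and \<open>2 * pi\<close>. So the limit need be computed for one lift only.\<close>

lemma polar_lift_unique:
  assumes "polar_lift p \<theta>" "polar_lift p \<theta>'" and nz: "\<And>i. p i \<noteq> 0"
  shows "\<theta> n - \<theta> 0 = \<theta>' n - \<theta>' 0"
proof -
  have cs: "cos (\<theta> i) = cos (\<theta>' i) \<and> sin (\<theta> i) = sin (\<theta>' i)" for i
  proof -
    have "norm (p i) *\<^sub>R (cos (\<theta> i), sin (\<theta> i)) = norm (p i) *\<^sub>R (cos (\<theta>' i), sin (\<theta>' i))"
      using assms(1,2) unfolding polar_lift_def by metis
    then show ?thesis using nz[of i] by simp
  qed
  have step: "\<theta> (Suc i) - \<theta> i = \<theta>' (Suc i) - \<theta>' i" for i
  proof -
    define u where "u = \<theta> (Suc i) - \<theta> i"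
    define v where "v = \<theta>' (Suc i) - \<theta>' i"
    have "cos (u - v) = 1"
      unfolding u_def v_def by (simp add: cs cos_diff sin_diff)
        (use sin_cos_squared_add3[of "\<theta>' i"] sin_cos_squared_add3[of "\<theta>' (Suc i)"] in algebra)
    then obtain k :: int where k: "u - v = of_int k * 2 * pi"
      using cos_one_2pi_int by auto
    have "0 < u" "u < 2 * pi" "0 < v" "v < 2 * pi"
      using assms(1,2) by (auto simp: u_def v_def polar_lift_def)
    then have "of_int k * (2 * pi) < 1 * (2 * pi)" "(- 1) * (2 * pi) < of_int k * (2 * pi)"
      using k by linarith+
    then have "of_int k < (1::real)" "(-1::real) < of_int k"
      by (simp_all only: mult_less_cancel_right_pos[OF mult_pos_pos[OF zero_less_numeral pi_gt_zero]])
    then have "k = 0" by linarith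
    then show ?thesis using k by (simp add: u_def v_def)
  qed
  show ?thesis
  proof (induction n)
    case (Suc n)
    then show ?case using step[of n] by linarith
  qed simp
qed

lemma sin_half_squared: "(sin (z / 2))\<^sup>2 = (1 - cos z) / 2" for z :: real
  using cos_double_sin[of "z / 2"] by simp

lemma cos_half_squared: "(cos (z / 2))\<^sup>2 = (1 + cos z) / 2" for z :: real
  using cos_double_cos[of "z / 2"] by simp

section \<open>Constants of the table and the caustic\<close>

locale confocal_caustic =
  fixes a b l :: real
  assumes b_pos: "0 < b" and b_less_a: "b < a" and l_pos: "0 < l" and l_less: "l < b\<^sup>2"
begin

text \<open>
  The line through \<open>P(x)\<close> and \<open>P(y)\<close> is \<open>- X sin m / a + Y cos m / b = cos d\<close> with
  \<open>m = (x + y) / 2\<close> and \<open>d = (y - x) / 2\<close>. It is tangent to the caustic iff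
  \<open>(a\<^sup>2 - l) sin\<^sup>2 m / a\<^sup>2 + (b\<^sup>2 - l) cos\<^sup>2 m / b\<^sup>2 = cos\<^sup>2 d\<close>; passing to double angles yields
  the constants \<open>\<mu>\<close> and \<open>\<nu>\<close>. The constant \<open>\<kappa>\<close> is the squared modulus.
\<close>

definition \<mu> :: real where "\<mu> = 1 - l * (a\<^sup>2 + b\<^sup>2) / (a\<^sup>2 * b\<^sup>2)"
definition \<nu> :: real where "\<nu> = l * (a\<^sup>2 - b\<^sup>2) / (a\<^sup>2 * b\<^sup>2)"
definition \<kappa> :: real where "\<kappa> = (a\<^sup>2 - b\<^sup>2) / (a\<^sup>2 - l)"

lemma a_pos: "0 < a" using b_pos b_less_a by simp
lemma sq_less: "b\<^sup>2 < a\<^sup>2" using b_pos b_less_a by (intro power_strict_mono) auto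
lemma nu_pos: "0 < \<nu>"
  using sq_less l_pos a_pos b_pos by (simp add: \<nu>_def)
lemma mu_plus_nu: "\<mu> + \<nu> = 1 - 2 * l / a\<^sup>2"
  using a_pos b_pos by (simp add: \<mu>_def \<nu>_def field_simps)
lemma mu_minus_nu: "\<mu> - \<nu> = 1 - 2 * l / b\<^sup>2"
  using a_pos b_pos by (simp add: \<mu>_def \<nu>_def field_simps)
lemma mu_nu_scaled: "a\<^sup>2 * b\<^sup>2 * (1 - \<mu>) = l * (a\<^sup>2 + b\<^sup>2)" "a\<^sup>2 * b\<^sup>2 * \<nu> = l * (a\<^sup>2 - b\<^sup>2)"
  using a_pos b_pos by (simp_all add: \<mu>_def \<nu>_def)
lemma kappa_bounds: "0 < \<kappa>" "\<kappa> < 1"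
  using sq_less l_less l_pos by (auto simp: \<kappa>_def)

lemma mu_nu_cos_bounds: "- 1 < \<mu> - \<nu> * cos t" "\<mu> - \<nu> * cos t < 1"
proof -
  have "2 * l / a\<^sup>2 > 0" "2 * l / b\<^sup>2 < 2"
    using a_pos b_pos l_pos l_less by (auto simp: field_simps)
  then have "\<mu> + \<nu> < 1" "- 1 < \<mu> - \<nu>" using mu_plus_nu mu_minus_nu by linarith+
  moreover have "\<nu> * cos t \<le> \<nu> * 1" "\<nu> * (- 1) \<le> \<nu> * cos t"
    using nu_pos by (intro mult_left_mono; simp)+
  ultimately show "- 1 < \<mu> - \<nu> * cos t" "\<mu> - \<nu> * cos t < 1" by linarith+
qed

section \<open>Tangent chords in parameters and the invariant increment\<close>

definition pt :: "real \<Rightarrow> point" where "pt x = (- a * sin x, b * cos x)"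

text \<open>The parameters are reals, not angles modulo \<open>2 * pi\<close>, so a trajectory
  becomes an increasing real sequence.\<close>

definition tangent_step :: "real \<Rightarrow> real \<Rightarrow> bool" where
  "tangent_step x y \<longleftrightarrow> 0 < y - x \<and> y - x < pi \<and> cos (y - x) = \<mu> - \<nu> * cos (x + y)"

definition width :: "real \<Rightarrow> real" where "width t = arccos (\<mu> - \<nu> * cos t)"

lemma width_bounds: "0 < width t" "width t < pi"
  using mu_nu_cos_bounds[of t] arccos_lt_bounded[of "\<mu> - \<nu> * cos t"] by (auto simp: width_def)

lemma cos_width: "cos (width t) = \<mu> - \<nu> * cos t"
  using mu_nu_cos_bounds[of t] by (simp add: width_def)

lemma tangent_step_iff_width: "tangent_step x y \<longleftrightarrow> y - x = width (x + y)"
proof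
  assume "tangent_step x y"
  then show "y - x = width (x + y)"
    unfolding tangent_step_def width_def by (metis arccos_cos less_imp_le)
next
  assume *: "y - x = width (x + y)"
  show "tangent_step x y"
    unfolding tangent_step_def * using width_bounds cos_width by blast
qed

text \<open>Equivalent to the derivative of \<open>width\<close> being less than 1 in absolute
  value.\<close>

lemma sin_width_gt: "\<nu> * \<bar>sin t\<bar> < sin (width t)"
proof -
  have "1 - (\<mu> - \<nu> * cos t)\<^sup>2 - (\<nu> * sin t)\<^sup>2 > 0"
  proof -
    \<comment> \<open>The expression is affine in \<open>cos t\<close>, hence a convex combination
      of its values at \<open>cos t = 1\<close> and \<open>cos t = - 1\<close>.\<close>
    have eq: "1 - (\<mu> - \<nu> * cos t)\<^sup>2 - (\<nu> * sin t)\<^sup>2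
      = (1 + cos t) / 2 * (1 - (\<mu> - \<nu>)\<^sup>2) + (1 - cos t) / 2 * (1 - (\<mu> + \<nu>)\<^sup>2)"
      by (simp add: power_mult_distrib sin_squared_eq) (simp add: field_simps power2_eq_square)
    have m: "1 - (\<mu> - \<nu>)\<^sup>2 > 0" "1 - (\<mu> + \<nu>)\<^sup>2 > 0"
      using mu_nu_cos_bounds[of 0] mu_nu_cos_bounds[of pi] by (auto simp: abs_square_less_1)
    show ?thesis
    proof (cases "cos t = 1")
      case True
      then show ?thesis unfolding eq using m by simp
    next
      case False
      then have "(1 - cos t) / 2 > 0" by (simp add: less_le)
      moreover have "(1 + cos t) / 2 \<ge> 0"
        by (intro divide_nonneg_nonneg) (use cos_ge_minus_one[of t] in linarith, simp)
      ultimately show ?thesis unfolding eq using m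
        by (intro add_nonneg_pos mult_nonneg_nonneg mult_pos_pos) auto
    qed
  qed
  moreover have "(sin (width t))\<^sup>2 = 1 - (\<mu> - \<nu> * cos t)\<^sup>2"
    using sin_squared_eq[of "width t"] cos_width by simp
  ultimately have "(\<nu> * \<bar>sin t\<bar>)\<^sup>2 < (sin (width t))\<^sup>2" by (simp add: power_mult_distrib)
  moreover have "sin (width t) > 0" using width_bounds sin_gt_zero by blast
  ultimately show ?thesis using power2_less_imp_less by force
qed

lemma width_has_derivative:
  "(width has_real_derivative - \<nu> * sin t / sin (width t)) (at t)"
proof -
  have s: "sin (width t) = sqrt (1 - (\<mu> - \<nu> * cos t)\<^sup>2)"
    using mu_nu_cos_bounds[of t] by (simp add: width_def sin_arccos)
  show ?thesis
    unfolding s unfolding width_def using mu_nu_cos_bounds[of t]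
    by (auto intro!: derivative_eq_intros simp: divide_inverse)
qed

lemma delta_pos: "0 < 1 - \<kappa> * (sin x)\<^sup>2"
proof -
  have "(sin x)\<^sup>2 \<le> 1" using abs_sin_le_one abs_square_le_1 by blast
  then have "\<kappa> * (sin x)\<^sup>2 \<le> \<kappa> * 1" using kappa_bounds by (intro mult_left_mono) auto
  then show ?thesis using kappa_bounds by linarith
qed

text \<open>
  Since \<open>w' = - \<nu> sin t / sin w\<close>, this says that \<open>G((t + w) / 2)\<close> and \<open>G((t - w) / 2)\<close> have the
  same derivative. After squaring it becomes polynomial in the sines and cosines of \<open>t\<close> and \<open>w\<close>;
  \<open>sin_width_gt\<close> permits taking roots again.
\<close>

lemma delta_balance:
  fixes t :: real
  defines "S \<equiv> sin (width t)"
  shows "(S - \<nu> * sin t) * sqrt (1 - \<kappa> * (sin ((t - width t) / 2))\<^sup>2)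
       = (S + \<nu> * sin t) * sqrt (1 - \<kappa> * (sin ((t + width t) / 2))\<^sup>2)"
proof -
  define s C T where "s = sin t" and "C = cos t" and "T = cos (width t)"
  have T: "T = \<mu> - \<nu> * C" by (simp add: T_def C_def cos_width)
  have S2: "S\<^sup>2 = 1 - T\<^sup>2" and s2: "s\<^sup>2 = 1 - C\<^sup>2"
    by (simp_all add: S_def T_def s_def C_def sin_squared_eq)
  \<comment> \<open>The relation between \<open>\<kappa>\<close> and the width equation that makes
    the balance hold; being linear in \<open>\<kappa>\<close>, it determines the modulus.\<close>
  have param: "\<kappa> * (1 - \<mu>\<^sup>2 + \<nu>\<^sup>2) = 2 * \<nu> * (2 - \<kappa>)"
  proof -
    have *: "1 - \<mu>\<^sup>2 + \<nu>\<^sup>2 = 2 * l * (a\<^sup>2 + b\<^sup>2 - 2 * l) / (a\<^sup>2 * b\<^sup>2)"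
      using a_pos b_pos by (simp add: \<mu>_def \<nu>_def field_simps power2_eq_square)
    have "a\<^sup>2 - l > 0" using l_less sq_less by linarith
    then have "2 - \<kappa> = (a\<^sup>2 + b\<^sup>2 - 2 * l) / (a\<^sup>2 - l)" by (simp add: \<kappa>_def field_simps)
    show ?thesis unfolding * \<open>2 - \<kappa> = _\<close> unfolding \<kappa>_def \<nu>_def
      by (simp only: times_divide_eq_left times_divide_eq_right divide_divide_eq_left mult_ac)
  qed
  \<comment> \<open>The two sides of the squared balance differ by \<open>s * S\<close> times the
    difference of the two sides here.\<close>
  have "\<kappa> * (S\<^sup>2 + \<nu>\<^sup>2 * s\<^sup>2) = 2 * \<nu> * (2 - \<kappa> + \<kappa> * C * T)"
    unfolding S2 s2 T using param by algebra
  then have sq: "(S - \<nu> * s)\<^sup>2 * (1 - \<kappa> * ((1 - (C * T + s * S)) / 2))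
      = (S + \<nu> * s)\<^sup>2 * (1 - \<kappa> * ((1 - (C * T - s * S)) / 2))"
    by (simp add: field_simps power2_eq_square) algebra
  have "\<bar>\<nu> * s\<bar> < S"
    using sin_width_gt[of t] nu_pos by (simp add: abs_mult S_def s_def)
  then have nn: "0 \<le> S - \<nu> * s" "0 \<le> S + \<nu> * s" by linarith+
  have "sqrt ((S - \<nu> * s)\<^sup>2 * (1 - \<kappa> * (sin ((t - width t) / 2))\<^sup>2))
      = sqrt ((S + \<nu> * s)\<^sup>2 * (1 - \<kappa> * (sin ((t + width t) / 2))\<^sup>2))"
    unfolding sin_half_squared cos_diff cos_add using sq by (simp add: S_def s_def C_def T_def)
  then show ?thesis using nn by (simp add: real_sqrt_mult s_def)
qed

text \<open>A form of Euler's addition theorem: the tangency relation integrates the equation that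
  equates \<open>dx / sqrt (1 - \<kappa> * (sin x)\<^sup>2)\<close> with the same expression in
  \<open>y\<close>.\<close>

lemma step_increment_const:
  assumes G: "\<And>x. (G has_real_derivative 1 / sqrt (1 - \<kappa> * (sin x)\<^sup>2)) (at x)"
  shows "G ((t + width t) / 2) - G ((t - width t) / 2) = G (width 0 / 2) - G (- width 0 / 2)"
proof -
  let ?H = "\<lambda>t. G ((t + width t) / 2) - G ((t - width t) / 2)"
  have "(?H has_real_derivative 0) (at t)" for t
  proof -
    define S where "S = sin (width t)"
    have "S > 0" unfolding S_def using width_bounds sin_gt_zero by blast
    let ?p = "sqrt (1 - \<kappa> * (sin ((t + width t) / 2))\<^sup>2)"
    let ?m = "sqrt (1 - \<kappa> * (sin ((t - width t) / 2))\<^sup>2)"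
    have pm: "?p > 0" "?m > 0" using delta_pos by auto
    have "(?H has_real_derivative
        1 / ?p * ((1 + - \<nu> * sin t / S) / 2) - 1 / ?m * ((1 - - \<nu> * sin t / S) / 2)) (at t)"
      unfolding S_def
      by (intro DERIV_diff DERIV_chain2[OF G] DERIV_cdivide DERIV_add DERIV_ident width_has_derivative)
    moreover have "1 / ?p * ((1 + - \<nu> * sin t / S) / 2) - 1 / ?m * ((1 - - \<nu> * sin t / S) / 2) = 0"
    proof -
      have "1 / ?p * ((1 + - \<nu> * sin t / S) / 2) = (S - \<nu> * sin t) / (2 * S * ?p)"
        "1 / ?m * ((1 - - \<nu> * sin t / S) / 2) = (S + \<nu> * sin t) / (2 * S * ?m)"
        using \<open>S > 0\<close> by (simp_all add: field_simps)
      moreover have "(S - \<nu> * sin t) / (2 * S * ?p) = (S + \<nu> * sin t) / (2 * S * ?m)"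
        using delta_balance[of t] pm \<open>S > 0\<close> unfolding S_def[symmetric]
        by (simp add: frac_eq_eq mult.assoc mult.left_commute)
      ultimately show ?thesis by simp
    qed
    ultimately show ?thesis by simp
  qed
  then have "?H t = ?H 0" by (intro DERIV_isconst_all) auto
  then show ?thesis by simp
qed

section \<open>Chords tangent to the caustic obey the reflection law\<close>

lemma pt_in_ellipse: "pt x \<in> ellipse (a\<^sup>2) (b\<^sup>2)"
  using a_pos b_pos by (simp add: pt_def ellipse_def power_mult_distrib)

lemma pt_nonzero: "pt x \<noteq> 0"
proof
  assume "pt x = 0"
  then have "sin x = 0" "cos x = 0" using a_pos b_pos by (auto simp: pt_def zero_prod_def)
  then show False using sin_cos_squared_add[of x] by simp
qed

lemma ellipse_eq_pt:
  assumes "p \<in> ellipse (a\<^sup>2) (b\<^sup>2)"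
  obtains x where "0 \<le> x" "x < 2 * pi" "p = pt x"
proof -
  obtain p1 p2 where p: "p = (p1, p2)" by (cases p)
  have "(p2 / b)\<^sup>2 + (- p1 / a)\<^sup>2 = 1"
    using assms by (simp add: ellipse_def p power_divide)
  then obtain x where "0 \<le> x" "x < 2 * pi" "p2 / b = cos x" "- p1 / a = sin x"
    using sincos_total_2pi by metis
  then show ?thesis
    using that[of x] a_pos b_pos by (simp add: p pt_def field_simps)
qed

text \<open>Sum-to-product formulas split off a scalar, positive for
  \<open>0 < y - x < 2 * pi\<close>, from a direction depending only on
  \<open>x + y\<close>.\<close>

lemma chord:
  "pt y - pt x = (2 * sin ((y - x) / 2)) *\<^sub>R (- a * cos ((x + y) / 2), - b * sin ((x + y) / 2))"
proof -
  have "a * sin x - a * sin y = a * (sin x - sin y)" "b * cos y - b * cos x = b * (cos y - cos x)"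
    by (simp_all add: algebra_simps)
  moreover have "sin ((x - y) / 2) = - sin ((y - x) / 2)"
    by (metis minus_diff_eq minus_divide_left sin_minus)
  ultimately show ?thesis
    by (simp add: pt_def sin_diff_sin[of x y] cos_diff_cos[of y x] add.commute)
qed

lemma tangent_step_pt_neq:
  assumes "tangent_step x y"
  shows "pt y \<noteq> pt x"
proof
  assume "pt y = pt x"
  then have e: "sin y = sin x" "cos y = cos x"
    using a_pos b_pos by (auto simp: pt_def)
  have "sin (y - x) > 0"
    using assms by (intro sin_gt_zero) (auto simp: tangent_step_def)
  then show False by (simp add: sin_diff e)
qed

text \<open>The right side is \<open>l\<close> times the squared length of the direction vector in
  \<open>chord\<close>, so this serves to normalise tangent chords.\<close>

lemma tangency_half_angles:
  assumes "tangent_step x y"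
  shows "(a * b * sin ((y - x) / 2))\<^sup>2 = l * (a\<^sup>2 * (cos ((x + y) / 2))\<^sup>2 + b\<^sup>2 * (sin ((x + y) / 2))\<^sup>2)"
proof -
  define s m where "s = (sin ((y - x) / 2))\<^sup>2" and "m = (sin ((x + y) / 2))\<^sup>2"
  have "1 - 2 * s = cos (y - x)" "1 - 2 * m = cos (x + y)"
    unfolding s_def m_def sin_half_squared by (simp_all add: field_simps)
  then have "1 - 2 * s = \<mu> - \<nu> * (1 - 2 * m)"
    using assms by (simp add: tangent_step_def)
  then have "a\<^sup>2 * b\<^sup>2 * s = l * (a\<^sup>2 * (1 - m) + b\<^sup>2 * m)"
    using mu_nu_scaled by algebra
  then show ?thesis by (simp add: power_mult_distrib cos_squared_eq s_def m_def)
qed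

lemma sgn_chord:
  assumes "tangent_step x y"
  shows "sgn (pt y - pt x) = (sqrt l / (a * b * sin ((y - x) / 2))) *\<^sub>R
    (- a * cos ((x + y) / 2), - b * sin ((x + y) / 2))"
proof -
  let ?w = "(- a * cos ((x + y) / 2), - b * sin ((x + y) / 2))"
  have s: "sin ((y - x) / 2) > 0"
    using assms by (intro sin_gt_zero) (auto simp: tangent_step_def)
  have "sqrt l * norm ?w = sqrt ((a * b * sin ((y - x) / 2))\<^sup>2)"
    unfolding tangency_half_angles[OF assms]
    by (simp add: norm_Pair power_mult_distrib real_sqrt_mult)
  also have "\<dots> = a * b * sin ((y - x) / 2)" using s a_pos b_pos by simp
  finally have n: "sqrt l * norm ?w = a * b * sin ((y - x) / 2)" .
  have "norm ?w > 0" using n s a_pos b_pos l_pos by (metis mult_eq_0_iff less_irrefl zero_less_norm_iff norm_eq_zero)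
  then have "inverse (norm ?w) = sqrt l / (a * b * sin ((y - x) / 2))"
    unfolding n[symmetric] using l_pos by (simp add: field_simps)
  moreover have "sgn (pt y - pt x) = sgn ?w"
    unfolding chord sgn_scaleR using s by simp
  ultimately show ?thesis by (simp only: sgn_div_norm)
qed

text \<open>
  Joachimsthal's integral: on every chord tangent to the caustic, the unit direction has inner
  product \<open>\<plusminus> sqrt l / (a b)\<close> with the normals at the two ends. Hence two tangent chords meeting at
  \<open>P(y)\<close> obey the reflection law, as soon as their directions are not opposite.
\<close>

lemma tangent_steps_reflect:
  assumes xy: "tangent_step x y" and yz: "tangent_step y z"
  shows "sgn (pt z - pt y) = reflect_dir (ellipse_normal (a\<^sup>2) (b\<^sup>2) (pt y)) (sgn (pt y - pt x))"
proof -
  define m m' where "m = (x + y) / 2" and "m' = (y + z) / 2"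
  define d d' where "d = (y - x) / 2" and "d' = (z - y) / 2"
  define c c' where "c = sqrt l / (a * b * sin d)" and "c' = sqrt l / (a * b * sin d')"
  have u: "sgn (pt y - pt x) = c *\<^sub>R (- a * cos m, - b * sin m)"
    and v: "sgn (pt z - pt y) = c' *\<^sub>R (- a * cos m', - b * sin m')"
    using sgn_chord[OF xy] sgn_chord[OF yz] by (simp_all add: m_def m'_def d_def d'_def c_def c'_def)
  have s: "sin d > 0" "sin d' > 0"
    using xy yz unfolding d_def d'_def tangent_step_def by (auto intro!: sin_gt_zero)
  have n: "ellipse_normal (a\<^sup>2) (b\<^sup>2) (pt y) = (- sin y / a, cos y / b)"
    using a_pos b_pos by (simp add: ellipse_normal_def pt_def power2_eq_square)
  show ?thesis
  proof (rule reflect_dir_unique)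
    show "ellipse_normal (a\<^sup>2) (b\<^sup>2) (pt y) \<noteq> 0"
      using sin_zero_abs_cos_one[of y] a_pos b_pos by (auto simp: n zero_prod_def)
    show "norm (sgn (pt y - pt x)) = norm (sgn (pt z - pt y))"
      using tangent_step_pt_neq[OF xy] tangent_step_pt_neq[OF yz] by (simp add: norm_sgn)
    have ud: "sgn (pt y - pt x) \<bullet> ellipse_normal (a\<^sup>2) (b\<^sup>2) (pt y) = c * sin (y - m)"
      using a_pos b_pos unfolding u n sin_diff by (simp add: inner_prod_def field_simps)
    have vd: "sgn (pt z - pt y) \<bullet> ellipse_normal (a\<^sup>2) (b\<^sup>2) (pt y) = - (c' * sin (m' - y))"
      using a_pos b_pos unfolding v n sin_diff by (simp add: inner_prod_def field_simps)
    \<comment> \<open>These sines cancel the denominators of \<open>c\<close> and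
      \<open>c'\<close>.\<close>
    have "y - m = d" "m' - y = d'" by (simp_all add: m_def m'_def d_def d'_def field_simps)
    then show "sgn (pt z - pt y) \<bullet> ellipse_normal (a\<^sup>2) (b\<^sup>2) (pt y)
        = - (sgn (pt y - pt x) \<bullet> ellipse_normal (a\<^sup>2) (b\<^sup>2) (pt y))"
      unfolding ud vd using s by (simp add: c_def c'_def)
    show "sgn (pt y - pt x) + sgn (pt z - pt y) \<noteq> 0"
    proof
      assume "sgn (pt y - pt x) + sgn (pt z - pt y) = 0"
      then have "a * (c * cos m + c' * cos m') = 0" "b * (c * sin m + c' * sin m') = 0"
        unfolding u v by (auto simp: zero_prod_def algebra_simps)
      then have "c * cos m + c' * cos m' = 0" "c * sin m + c' * sin m' = 0"
        using a_pos b_pos by auto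
      then have "c * c' * sin (m' - m) = 0" unfolding sin_diff by algebra
      moreover have "c > 0" "c' > 0" using s l_pos a_pos b_pos by (simp_all add: c_def c'_def)
      \<comment> \<open>\<open>m' - m\<close> is \<open>(z - x) / 2\<close>, strictly between 0 and
        \<open>pi\<close>.\<close>
      moreover have "sin (m' - m) > 0"
        using xy yz unfolding m_def m'_def tangent_step_def by (intro sin_gt_zero) (auto simp: field_simps)
      ultimately show False by simp
    qed
  qed
qed

section \<open>Existence of trajectories\<close>

text \<open>With \<open>t = x + y\<close> the task is to solve \<open>t - width t = 2 * x\<close>;
  the bounds on \<open>width\<close> bracket a solution between \<open>2 * x\<close> and
  \<open>2 * x + pi\<close>.\<close>

lemma tangent_step_exists: "\<exists>y. tangent_step x y"
proof -
  have "continuous_on {2 * x..2 * x + pi} (\<lambda>t. t - width t)"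
    by (intro continuous_intros continuous_at_imp_continuous_on ballI DERIV_isCont[OF width_has_derivative])
  then obtain t where "t - width t = 2 * x"
    using IVT'[of "\<lambda>t. t - width t" "2 * x" "2 * x" "2 * x + pi"]
      width_bounds[of "2 * x"] width_bounds[of "2 * x + pi"] by auto
  then have "tangent_step x (t - x)" unfolding tangent_step_iff_width by simp
  then show ?thesis ..
qed

lemma tangent_chain_exists:
  assumes "tangent_step x y"
  obtains X where "X 0 = x" "X (Suc 0) = y" "\<And>i. tangent_step (X i) (X (Suc i))"
proof -
  define next_pt where "next_pt = (\<lambda>x. SOME y. tangent_step x y)"
  have *: "tangent_step x (next_pt x)" for x
    unfolding next_pt_def using tangent_step_exists someI_ex by metis
  \<comment> \<open>The prescribed \<open>y\<close> comes second; only later points are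
    chosen.\<close>
  define X where "X = case_nat x (\<lambda>i. (next_pt ^^ i) y)"
  have "tangent_step (X i) (X (Suc i))" for i
    using assms * by (cases i) (simp_all add: X_def)
  then show ?thesis using that[of X] by (simp add: X_def)
qed

lemma tangent_chain_billiard:
  assumes "\<And>i. tangent_step (X i) (X (Suc i))"
  shows "billiard_trajectory a b (\<lambda>i. pt (X i))"
  unfolding billiard_trajectory_def
  by (intro conjI allI pt_in_ellipse tangent_step_pt_neq tangent_steps_reflect assms)

section \<open>From geometric tangency to parameters\<close>

lemma invariant_curve_tangent_step:
  assumes "(p, q) \<in> invariant_curve a b l"
  obtains x y where "p = pt x" "q = pt y" "tangent_step x y"
proof -
  have pq: "p \<in> ellipse (a\<^sup>2) (b\<^sup>2)" "q \<in> ellipse (a\<^sup>2) (b\<^sup>2)" "p \<noteq> q"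
    and "ccw_tangent_line (a\<^sup>2 - l) (b\<^sup>2 - l) p q"
    using assms by (auto simp: invariant_curve_def)
  then obtain z t s where z': "z \<in> ellipse (a\<^sup>2 - l) (b\<^sup>2 - l)" "z = p + t *\<^sub>R (q - p)" "s > 0"
    "q - p = s *\<^sub>R ellipse_ccw_tangent (a\<^sup>2 - l) (b\<^sup>2 - l) z"
    unfolding ccw_tangent_line_def by blast
  obtain z1 z2 where "z = (z1, z2)" by (cases z)
  note z = z'[unfolded this]
  obtain x y0 where x: "p = pt x" "0 \<le> x" "x < 2 * pi" and y0: "q = pt y0" "0 \<le> y0" "y0 < 2 * pi"
    using ellipse_eq_pt pq by metis
  define y where "y = (if x < y0 then y0 else y0 + 2 * pi)"
  have "x \<noteq> y0" using pq x y0 by auto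
  then have y: "q = pt y" "0 < y - x" "y - x < 2 * pi"
    using x y0 by (auto simp: y_def pt_def)
  define A B where "A = a\<^sup>2 - l" and "B = b\<^sup>2 - l"
  have AB: "A > 0" "B > 0" using l_less sq_less by (auto simp: A_def B_def)
  define m d where "m = (x + y) / 2" and "d = (y - x) / 2"
  have d: "0 < d" "d < pi" using y by (auto simp: d_def)
  then have sd: "sin d > 0" by (rule sin_gt_zero)
  \<comment> \<open>\<open>r\<close> scales \<open>(- b * sin m, a * cos m)\<close>, which is normal
    to the chord, to the normal of the caustic at the touching point.\<close>
  define r where "r = 2 * sin d / s"
  have r: "r > 0" using sd z(3) by (simp add: r_def)
  have qp: "q - p = (2 * sin d) *\<^sub>R (- a * cos m, - b * sin m)"
    unfolding x(1) y(1) m_def d_def by (rule chord)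
  have v: "z2 / B = r * a * cos m" "z1 / A = - r * b * sin m"
    using z(3,4) unfolding qp ellipse_ccw_tangent_def A_def[symmetric] B_def[symmetric]
    by (auto simp: r_def field_simps)
  have "z1 = - a * sin x + t * (2 * sin d * (- a * cos m))"
    "z2 = b * cos x + t * (2 * sin d * (- b * sin m))"
    using z(2)[unfolded qp, unfolded x(1) pt_def] by auto
  moreover have on: "z1 * (z1 / A) + z2 * (z2 / B) = 1"
    using z(1) by (simp add: ellipse_def A_def B_def power2_eq_square)
  \<comment> \<open>The chord is orthogonal to this normal, so \<open>pt x\<close> may replace the
    touching point in its inner product with the normal.\<close>
  ultimately have "r * (a * b) * (cos m * cos x + sin m * sin x) = 1"
    unfolding v by algebra
  moreover have "m - x = d" by (simp add: m_def d_def field_simps)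
  ultimately have rc: "r * (a * b) * cos d = 1" using cos_diff[of m x] by simp
  \<comment> \<open>The counterclockwise orientation enters here, through
    \<open>r > 0\<close>.\<close>
  then have "cos d > 0"
    using r a_pos b_pos by (metis mult_pos_pos zero_less_mult_pos zero_less_one)
  then have "d < pi / 2"
    using d cos_ge_zero cos_monotone_0_pi_le[of "pi / 2" d] by (cases "d < pi / 2") auto
  have "z1 = A * (- r * b * sin m)" "z2 = B * (r * a * cos m)"
    using AB unfolding v[symmetric] by simp_all
  then have "r\<^sup>2 * (A * b\<^sup>2 * (sin m)\<^sup>2 + B * a\<^sup>2 * (cos m)\<^sup>2) = 1"
    using on unfolding v by algebra
  \<comment> \<open>Comparing the caustic equation with the square of \<open>rc\<close> eliminates
    \<open>r\<close>.\<close>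
  then have "r\<^sup>2 * (A * b\<^sup>2 * (sin m)\<^sup>2 + B * a\<^sup>2 * (cos m)\<^sup>2) = r\<^sup>2 * (a\<^sup>2 * b\<^sup>2 * (cos d)\<^sup>2)"
    using rc by algebra
  then have "A * b\<^sup>2 * (sin m)\<^sup>2 + B * a\<^sup>2 * (cos m)\<^sup>2 = a\<^sup>2 * b\<^sup>2 * (cos d)\<^sup>2"
    using r by simp
  then have "A * b\<^sup>2 * (1 - cos (x + y)) + B * a\<^sup>2 * (1 + cos (x + y)) = a\<^sup>2 * b\<^sup>2 * (1 + cos (y - x))"
    unfolding m_def d_def sin_half_squared cos_half_squared by linarith
  then have "a\<^sup>2 * b\<^sup>2 * cos (y - x) = a\<^sup>2 * b\<^sup>2 * (\<mu> - \<nu> * cos (x + y))"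
    using mu_nu_scaled unfolding A_def B_def by algebra
  then have "cos (y - x) = \<mu> - \<nu> * cos (x + y)" using a_pos b_pos by simp
  then have "tangent_step x y"
    using d \<open>d < pi / 2\<close> by (simp add: tangent_step_def d_def)
  then show ?thesis using that x(1) y(1) by blast
qed

text \<open>The witness is the horizontal line through the top vertex \<open>(0, \<beta>)\<close> of
  the caustic, run from right to left; \<open>h\<close> is half the length of its chord in the
  table.\<close>

lemma invariant_curve_nonempty: "invariant_curve a b l \<noteq> {}"
proof -
  define h where "h = a * sqrt l / b"
  define \<beta> where "\<beta> = sqrt (b\<^sup>2 - l)"
  have h: "h > 0" "h\<^sup>2 = a\<^sup>2 * l / b\<^sup>2"
    using a_pos b_pos l_pos by (auto simp: h_def power_divide power_mult_distrib)
  have \<beta>: "\<beta> > 0" "\<beta>\<^sup>2 = b\<^sup>2 - l" using l_less by (auto simp: \<beta>_def)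
  have "ccw_tangent_line (a\<^sup>2 - l) (b\<^sup>2 - l) (h, \<beta>) (- h, \<beta>)"
    unfolding ccw_tangent_line_def
  proof (intro bexI conjI exI)
    show "(0, \<beta>) = (h, \<beta>) + (1 / 2) *\<^sub>R ((- h, \<beta>) - (h, \<beta>))" by simp
    show "2 * h * \<beta> > 0" using h \<beta> by simp
    show "(- h, \<beta>) - (h, \<beta>) = (2 * h * \<beta>) *\<^sub>R ellipse_ccw_tangent (a\<^sup>2 - l) (b\<^sup>2 - l) (0, \<beta>)"
      using \<beta> unfolding \<beta>(2)[symmetric] by (simp add: ellipse_ccw_tangent_def power2_eq_square)
    show "(0, \<beta>) \<in> ellipse (a\<^sup>2 - l) (b\<^sup>2 - l)"
      using \<beta> l_less by (simp add: ellipse_def)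
  qed
  moreover have "(h, \<beta>) \<in> ellipse (a\<^sup>2) (b\<^sup>2)" "(- h, \<beta>) \<in> ellipse (a\<^sup>2) (b\<^sup>2)"
    using a_pos b_pos by (auto simp: ellipse_def h \<beta> field_simps)
  ultimately have "((h, \<beta>), (- h, \<beta>)) \<in> invariant_curve a b l"
    using h by (simp add: invariant_curve_def)
  then show ?thesis by blast
qed

section \<open>A continuous polar angle along the table\<close>

text \<open>The \<open>arctan\<close> term is the signed angle from \<open>(- sin x, cos x)\<close>
  to \<open>pt x\<close>: its argument is their cross product over their positive inner
  product.\<close>

definition polar_angle :: "real \<Rightarrow> real" where
  "polar_angle x = x + pi / 2 + arctan ((a - b) * sin x * cos x / (a * (sin x)\<^sup>2 + b * (cos x)\<^sup>2))"

lemma polar_angle_near: "\<bar>polar_angle x - (x + pi / 2)\<bar> < pi / 2"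
proof -
  let ?u = "(a - b) * sin x * cos x / (a * (sin x)\<^sup>2 + b * (cos x)\<^sup>2)"
  show ?thesis
    using arctan_lbound[of ?u] arctan_ubound[of ?u] unfolding polar_angle_def by linarith
qed

lemma pt_polar: "pt x = norm (pt x) *\<^sub>R (cos (polar_angle x), sin (polar_angle x))"
proof -
  \<comment> \<open>\<open>D\<close> and \<open>N\<close> are the coordinates of \<open>pt x\<close>
    in the standard frame rotated by \<open>x + pi / 2\<close>.\<close>
  define N D where "N = (a - b) * sin x * cos x" and "D = a * (sin x)\<^sup>2 + b * (cos x)\<^sup>2"
  define r where "r = norm (pt x)"
  have "r > 0" using pt_nonzero by (simp add: r_def)
  have "b * 1 \<le> D"
  proof -
    have "D = b * ((sin x)\<^sup>2 + (cos x)\<^sup>2) + (a - b) * (sin x)\<^sup>2"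
      unfolding D_def by algebra
    then show ?thesis using b_less_a by simp
  qed
  then have "D > 0" using b_pos by linarith
  have "r\<^sup>2 = (a * sin x)\<^sup>2 + (b * cos x)\<^sup>2" by (simp add: r_def pt_def norm_Pair)
  also have "\<dots> = D\<^sup>2 + N\<^sup>2"
    unfolding D_def N_def using sin_cos_squared_add[of x] by algebra
  finally have "1 + (N / D)\<^sup>2 = (r / D)\<^sup>2" using \<open>D > 0\<close> by (simp add: field_simps)
  then have q: "sqrt (1 + (N / D)\<^sup>2) = r / D" using \<open>D > 0\<close> \<open>r > 0\<close> by simp
  have \<delta>: "r * cos (arctan (N / D)) = D" "r * sin (arctan (N / D)) = N"
    unfolding cos_arctan sin_arctan q using \<open>D > 0\<close> \<open>r > 0\<close> by simp_all
  have "polar_angle x = (x + arctan (N / D)) + pi / 2"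
    by (simp add: polar_angle_def N_def D_def)
  then have "cos (polar_angle x) = - sin (x + arctan (N / D))"
    "sin (polar_angle x) = cos (x + arctan (N / D))"
    by (simp_all only: cos_add[of "x + arctan (N / D)"] sin_add[of "x + arctan (N / D)"]
      cos_pi_half sin_pi_half)
  then have "r * cos (polar_angle x) = - (sin x * D + cos x * N)"
    "r * sin (polar_angle x) = cos x * D - sin x * N"
    unfolding cos_add sin_add using \<delta> by algebra+
  moreover have "sin x * D + cos x * N = a * sin x" "cos x * D - sin x * N = b * cos x"
    unfolding D_def N_def using sin_cos_squared_add[of x] by algebra+
  ultimately show ?thesis by (simp add: r_def[symmetric]) (simp add: pt_def)
qed

text \<open>\<open>polar_angle_near\<close> alone puts the increment between \<open>- pi\<close> and
  \<open>2 * pi\<close>; its sine has the sign of \<open>sin (y - x)\<close>, which rules out values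
  up to 0.\<close>

lemma polar_angle_step:
  assumes "0 < y - x" "y - x < pi"
  shows "0 < polar_angle y - polar_angle x" "polar_angle y - polar_angle x < 2 * pi"
proof -
  let ?u = "polar_angle y - polar_angle x"
  define r r' where "r = norm (pt x)" and "r' = norm (pt y)"
  have r: "r > 0" "r' > 0" using pt_nonzero by (auto simp: r_def r'_def)
  have "r * cos (polar_angle x) = - a * sin x" "r * sin (polar_angle x) = b * cos x"
    "r' * cos (polar_angle y) = - a * sin y" "r' * sin (polar_angle y) = b * cos y"
    using pt_polar[of x] pt_polar[of y] unfolding r_def[symmetric] r'_def[symmetric] by (auto simp: pt_def)
  then have "r * r' * sin ?u = a * b * sin (y - x)"
    unfolding sin_diff by algebra
  moreover have "sin (y - x) > 0" using assms by (rule sin_gt_zero)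
  ultimately have s: "sin ?u > 0"
    using r a_pos b_pos by (metis mult_pos_pos zero_less_mult_pos)
  have range: "- pi < ?u" "?u < 2 * pi"
    using assms polar_angle_near[of x] polar_angle_near[of y] unfolding abs_less_iff by linarith+
  then show "?u < 2 * pi" by simp
  show "0 < ?u"
  proof (rule ccontr)
    assume "\<not> 0 < ?u"
    then have "sin (- ?u) \<ge> 0" using range by (intro sin_ge_zero) auto
    then show False using s unfolding sin_minus by linarith
  qed
qed

lemma tangent_chain_polar_lift:
  assumes "\<And>i. tangent_step (X i) (X (Suc i))"
  shows "polar_lift (\<lambda>i. pt (X i)) (\<lambda>i. polar_angle (X i))"
  unfolding polar_lift_def
proof (intro conjI allI)
  fix i
  show "pt (X i) = norm (pt (X i)) *\<^sub>R (cos (polar_angle (X i)), sin (polar_angle (X i)))"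
    by (rule pt_polar)
  have "0 < X (Suc i) - X i" "X (Suc i) - X i < pi" using assms[of i] by (auto simp: tangent_step_def)
  then show "0 < polar_angle (X (Suc i)) - polar_angle (X i)"
    "polar_angle (X (Suc i)) - polar_angle (X i) < 2 * pi"
    by (rule polar_angle_step)+
qed

section \<open>The elliptic antiderivative and the limit\<close>

text \<open>\<open>ellip_F\<close> vanishes for negative amplitudes, so an antiderivative on the
  whole line takes its place.\<close>

lemma elliptic_antiderivative:
  obtains G where "\<And>x. (G has_real_derivative 1 / sqrt (1 - \<kappa> * (sin x)\<^sup>2)) (at x)"
proof -
  have "isCont (\<lambda>x. 1 / sqrt (1 - \<kappa> * (sin x)\<^sup>2)) x" for x
    using delta_pos[of x] by (intro continuous_intros) auto
  then obtain G where "\<And>x. (G has_vector_derivative 1 / sqrt (1 - \<kappa> * (sin x)\<^sup>2)) (at x)"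
    using einterval_antiderivative[of "-\<infinity>" "\<infinity>" "\<lambda>x. 1 / sqrt (1 - \<kappa> * (sin x)\<^sup>2)"] by auto
  then show ?thesis using that[of G] by (simp add: has_real_derivative_iff_has_vector_derivative)
qed

context
  fixes G :: "real \<Rightarrow> real"
  assumes G: "\<And>x. (G has_real_derivative 1 / sqrt (1 - \<kappa> * (sin x)\<^sup>2)) (at x)"
begin

lemma antiderivative_eq_ellip_F:
  assumes "k\<^sup>2 = \<kappa>" "0 \<le> x"
  shows "ellip_F x k = G x - G 0"
proof -
  have "((\<lambda>t. 1 / sqrt (1 - \<kappa> * (sin t)\<^sup>2)) has_integral G x - G 0) {0..x}"
    using G assms(2) by (intro fundamental_theorem_of_calculus)
      (auto simp: has_real_derivative_iff_has_vector_derivative intro: has_vector_derivative_at_within)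
  then show ?thesis unfolding ellip_F_def assms(1) by (rule integral_unique)
qed

lemma antiderivative_odd: "G x - G (- x) = 2 * (G x - G 0)"
proof -
  have "((\<lambda>x. G x + G (- x)) has_real_derivative 0) (at x)" for x
    by (rule derivative_eq_intros DERIV_chain2[OF G] G refl | simp)+
  then have "G x + G (- x) = G 0 + G (- 0)" by (intro DERIV_isconst_all) auto
  then show ?thesis by simp
qed

lemma antiderivative_shift: "G (x + pi) = G x + 2 * (G (pi / 2) - G 0)"
proof -
  have "((\<lambda>x. G (x + pi) - G x) has_real_derivative 0) (at x)" for x
    by (rule derivative_eq_intros DERIV_chain2[OF G] G refl | simp)+
  \<comment> \<open>The constant is read off at \<open>- (pi / 2)\<close>, where
    \<open>antiderivative_odd\<close> applies.\<close>
  then have "G (x + pi) - G x = G (- (pi / 2) + pi) - G (- (pi / 2))"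
    by (intro DERIV_isconst_all) auto
  then show ?thesis using antiderivative_odd[of "pi / 2"] by simp
qed

lemma antiderivative_less:
  assumes "x < y"
  shows "G x < G y"
proof (rule DERIV_pos_imp_increasing[OF assms])
  fix z
  have "0 < 1 / sqrt (1 - \<kappa> * (sin z)\<^sup>2)" using delta_pos[of z] by simp
  then show "\<exists>d. (G has_real_derivative d) (at z) \<and> 0 < d" using G[of z] by blast
qed

lemma tangent_chain_polar_limit:
  assumes X: "\<And>i. tangent_step (X i) (X (Suc i))"
  shows "(\<lambda>N. (polar_angle (X N) - polar_angle (X 0)) / (2 * pi * real N))
    \<longlonglongrightarrow> (G (width 0 / 2) - G 0) / (2 * (G (pi / 2) - G 0))"
proof -
  define K L where "K = G (pi / 2) - G 0" and "L = G (width 0 / 2) - G 0"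
  have "K > 0" using antiderivative_less[of 0 "pi / 2"] by (simp add: K_def)
  have incr: "G (X N) = G (X 0) + 2 * real N * L" for N
  proof (induction N)
    case (Suc N)
    have "X (Suc N) - X N = width (X N + X (Suc N))" using X tangent_step_iff_width by blast
    then have "G (X (Suc N)) - G (X N) = 2 * L"
      using step_increment_const[OF G, of "X N + X (Suc N)"] antiderivative_odd[of "width 0 / 2"]
      by (simp add: L_def flip: \<open>X (Suc N) - X N = width (X N + X (Suc N))\<close>)
    then show ?case using Suc by (simp add: algebra_simps)
  qed simp
  \<comment> \<open>\<open>G\<close> gains \<open>2 * K\<close> over each interval of length
    \<open>pi\<close>, so removing this slope leaves a periodic function.\<close>
  define h where "h x = G x - 2 * K / pi * x" for x
  have "h (x + pi) = h x" for x
    using antiderivative_shift[of x] by (simp add: h_def K_def distrib_left)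
  moreover have "continuous_on UNIV h"
    unfolding h_def by (intro continuous_intros continuous_at_imp_continuous_on ballI DERIV_isCont[OF G])
  ultimately obtain C where C: "\<And>x. \<bar>h x\<bar> \<le> C"
    using periodic_bounded[of pi h] pi_gt_zero by blast
  \<comment> \<open>The term \<open>pi\<close> bounds two deviations of the polar angle from its
    parameter; the other bounds two values of \<open>h\<close>, rescaled by the inverse
    slope.\<close>
  define M where "M = pi + pi / (2 * K) * (2 * C)"
  have bound: "\<bar>(polar_angle (X N) - polar_angle (X 0)) / (2 * pi * real N) - L / (2 * K)\<bar>
      \<le> (M / (2 * pi)) / real N" if "N > 0" for N
  proof -
    define err where "err = polar_angle (X N) - polar_angle (X 0) - pi * real N * L / K"
    have "2 * K / pi * (X N - X 0) = 2 * real N * L - (h (X N) - h (X 0))"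
      using incr[of N] unfolding h_def by algebra
    moreover have "X N - X 0 = pi / (2 * K) * (2 * K / pi * (X N - X 0))"
      using \<open>K > 0\<close> by simp
    ultimately have "X N - X 0 = pi * real N * L / K - pi / (2 * K) * (h (X N) - h (X 0))"
      by (simp add: right_diff_distrib)
    then have "err = (polar_angle (X N) - X N - (polar_angle (X 0) - X 0))
        - pi / (2 * K) * (h (X N) - h (X 0))"
      unfolding err_def by linarith
    moreover have "\<bar>pi / (2 * K) * (h (X N) - h (X 0))\<bar> \<le> pi / (2 * K) * (2 * C)"
      unfolding abs_mult using \<open>K > 0\<close> C[of "X N"] C[of "X 0"] by (intro mult_mono) auto
    ultimately have "\<bar>err\<bar> \<le> M"
      using polar_angle_near[of "X N"] polar_angle_near[of "X 0"] unfolding M_def by linarith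
    have "(polar_angle (X N) - polar_angle (X 0)) / (2 * pi * real N) - L / (2 * K)
        = err / (2 * pi * real N)"
      using that \<open>K > 0\<close> by (simp add: err_def field_simps)
    then show ?thesis
      using \<open>\<bar>err\<bar> \<le> M\<close> that by (simp add: divide_right_mono)
  qed
  have "(\<lambda>N. (polar_angle (X N) - polar_angle (X 0)) / (2 * pi * real N) - L / (2 * K)) \<longlonglongrightarrow> 0"
  proof (rule Lim_null_comparison)
    show "(\<lambda>N. (M / (2 * pi)) / real N) \<longlonglongrightarrow> 0" by (rule lim_const_over_n)
    show "\<forall>\<^sub>F N in sequentially.
        norm ((polar_angle (X N) - polar_angle (X 0)) / (2 * pi * real N) - L / (2 * K))
        \<le> (M / (2 * pi)) / real N"
      using eventually_gt_at_top[of 0] by eventually_elim (use bound in simp)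
  qed
  then show ?thesis unfolding K_def L_def by (rule Lim_null[THEN iffD2])
qed

end

section \<open>The rotation number and its amplitude\<close>

lemma rotation_number:
  assumes "k\<^sup>2 = \<kappa>"
  shows "has_rotation_number a b l (ellip_F (width 0 / 2) k / (2 * ellip_K k))"
proof -
  obtain G where G: "\<And>x. (G has_real_derivative 1 / sqrt (1 - \<kappa> * (sin x)\<^sup>2)) (at x)"
    using elliptic_antiderivative by blast
  have FK: "ellip_F (width 0 / 2) k = G (width 0 / 2) - G 0" "ellip_K k = G (pi / 2) - G 0"
    unfolding ellip_K_def using width_bounds[of 0]
    by (auto intro!: antiderivative_eq_ellip_F[OF G assms])
  show ?thesis
    unfolding has_rotation_number_def FK
  proof (intro conjI allI impI ballI)
    show "invariant_curve a b l \<noteq> {}" by (rule invariant_curve_nonempty)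
  next
    fix qr assume "qr \<in> invariant_curve a b l"
    then obtain x y where qr: "qr = (pt x, pt y)" "tangent_step x y"
      using invariant_curve_tangent_step by (metis surj_pair)
    then obtain X where "X 0 = x" "X (Suc 0) = y" "\<And>i. tangent_step (X i) (X (Suc i))"
      using tangent_chain_exists by metis
    then show "case qr of (q, r) \<Rightarrow>
        \<exists>p \<theta>. billiard_trajectory a b p \<and> p 0 = q \<and> p 1 = r \<and> polar_lift p \<theta>"
      using tangent_chain_billiard[of X] tangent_chain_polar_lift[of X] unfolding qr by auto
  next
    fix p \<theta>
    assume p: "billiard_trajectory a b p" "(p 0, p 1) \<in> invariant_curve a b l" "polar_lift p \<theta>"
    obtain x y where xy: "p 0 = pt x" "p 1 = pt y" "tangent_step x y"
      using invariant_curve_tangent_step[OF p(2)] by metis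
    then obtain X where X: "X 0 = x" "X (Suc 0) = y" "\<And>i. tangent_step (X i) (X (Suc i))"
      using tangent_chain_exists by metis
    \<comment> \<open>Uniqueness turns an arbitrary trajectory into the explicit chain.\<close>
    have "p = (\<lambda>i. pt (X i))"
      using xy X by (intro billiard_trajectory_unique[OF a_pos b_pos p(1) tangent_chain_billiard]) auto
    then have "\<theta> N - \<theta> 0 = polar_angle (X N) - polar_angle (X 0)" for N
      using polar_lift_unique[OF p(3)] tangent_chain_polar_lift[of X] X(3) pt_nonzero by simp
    then show "(\<lambda>N. (\<theta> N - \<theta> 0) / (2 * pi * real N))
        \<longlonglongrightarrow> (G (width 0 / 2) - G 0) / (2 * (G (pi / 2) - G 0))"
      using tangent_chain_polar_limit[of G X, OF G X(3)] by simp
  qed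
qed

text \<open>Identifies the amplitude \<open>width 0 / 2\<close>: by the double-angle formula,
  \<open>1 - 2 * l / b\<^sup>2\<close> is the cosine of twice the arcsine.\<close>

lemma width_zero: "width 0 = 2 * arcsin (sqrt l / b)"
proof -
  have q: "0 \<le> sqrt l / b" "sqrt l / b \<le> 1"
    using b_pos l_pos l_less by (auto simp: real_le_lsqrt)
  have "cos (2 * arcsin (sqrt l / b)) = \<mu> - \<nu> * cos 0"
    using q l_pos by (simp add: cos_double_sin mu_minus_nu power_divide)
  moreover have "0 \<le> arcsin (sqrt l / b)" "arcsin (sqrt l / b) \<le> pi / 2"
    using q arcsin_le_arcsin[of 0 "sqrt l / b"] arcsin_bounded[of "sqrt l / b"] by auto
  ultimately show ?thesis
    using arccos_cos[of "2 * arcsin (sqrt l / b)"] by (simp add: width_def)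
qed

end

theorem theorem7p1:
  fixes a b l c e f k \<phi> :: real
  assumes "0 < b" and "b < a"
    and "0 < l" and "l < b\<^sup>2"
    and "c = sqrt (a\<^sup>2 - b\<^sup>2)"
    and "e = a / c"
    and "f = sqrt (a\<^sup>2 - l) / c"
    and "k = 1 / f"
    and "\<phi> = arcsin (sqrt ((e\<^sup>2 - f\<^sup>2) / (e\<^sup>2 - 1)))"
  shows "\<phi> = arcsin (sqrt l / b) \<and>
         has_rotation_number a b l (ellip_F \<phi> k / (2 * ellip_K k))"
proof -
  interpret confocal_caustic a b l using assms by unfold_locales
  have c2: "c\<^sup>2 = a\<^sup>2 - b\<^sup>2" "c > 0" using assms(5) sq_less by auto
  have al: "a\<^sup>2 - l > 0" using l_less sq_less by linarith
  have e2: "e\<^sup>2 = a\<^sup>2 / c\<^sup>2" and f2: "f\<^sup>2 = (a\<^sup>2 - l) / c\<^sup>2"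
    using assms(6,7) al by (simp_all add: power_divide)
  have "e\<^sup>2 - f\<^sup>2 = l / c\<^sup>2" "e\<^sup>2 - 1 = b\<^sup>2 / c\<^sup>2"
    using c2 unfolding e2 f2 by (simp_all add: field_simps)
  then have "(e\<^sup>2 - f\<^sup>2) / (e\<^sup>2 - 1) = l / b\<^sup>2" using c2(2) by simp
  then have phi: "\<phi> = arcsin (sqrt l / b)"
    using assms(9) b_pos by (simp add: real_sqrt_divide)
  have "k\<^sup>2 = \<kappa>"
    using assms(8) f2 c2 by (simp add: \<kappa>_def power_divide)
  then show ?thesis using rotation_number[of k] width_zero phi by simp
qed

end
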